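(* Let $a_{jk}(t)$ ($j,k=1,2$) be real-valued continuous functions on $[t_0,+\infty)$, where $a_{12}$ and $a_{21}$ have unbounded supports. If $a_{12}(t)\ge0$ and $a_{21}(t)\ge0$ for all $t\ge t_0$, then the system $$\phi'=a_{11}(t)\phi+a_{12}(t)\psi,\qquad \psi'=a_{21}(t)\phi+a_{22}(t)\psi,\qquad t\ge t_0,$$ satisfies the non conjugation condition on $[t_0,+\infty)$.
   Context: All solutions are real-valued. A continuous function $u(t)$ on $[t_1,+\infty)$ ($t_1\ge t_0$) vanishes no more than one time on $[t_1,+\infty)$ if it has no zeros on $[t_1,+\infty)$ or the set of its zeros on $[t_1,+\infty)$ is a segment $[a,b]$, possibly degenerating to a single point. The system satisfies the non conjugation condition on $[t_1,+\infty)$ if for each of its nontrivial solutions $(\phi(t),\psi(t))$ each of the functions $\phi(t)$ and $\psi(t)$ vanishes on $[t_1,+\infty)$ no more than one time. *)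

theory Defs
  imports "HOL-Analysis.Analysis"
begin

(* The derivative is taken within the half-line, so it is one-sided at t0 and
   the values of the functions to the left of t0 play no role. *)
definition solves_system ::
  "(real \<Rightarrow> real) \<Rightarrow> (real \<Rightarrow> real) \<Rightarrow> (real \<Rightarrow> real) \<Rightarrow> (real \<Rightarrow> real) \<Rightarrow> real
    \<Rightarrow> (real \<Rightarrow> real) \<Rightarrow> (real \<Rightarrow> real) \<Rightarrow> bool"
where
  "solves_system a11 a12 a21 a22 t0 \<phi> \<psi> \<longleftrightarrow>
    (\<forall>t\<ge>t0.
      (\<phi> has_real_derivative a11 t * \<phi> t + a12 t * \<psi> t) (at t within {t0..}) \<and>
      (\<psi> has_real_derivative a21 t * \<phi> t + a22 t * \<psi> t) (at t within {t0..}))"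

definition vanishes_at_most_once :: "(real \<Rightarrow> real) \<Rightarrow> real \<Rightarrow> bool"
where
  "vanishes_at_most_once u t1 \<longleftrightarrow>
    {t \<in> {t1..}. u t = 0} = {} \<or> (\<exists>a b. a \<le> b \<and> {t \<in> {t1..}. u t = 0} = {a..b})"

(* t0 is the initial point of the system, t1 \<ge> t0 that of the half-line on which
   zeros are considered; a solution is nontrivial if the pair is not identically
   zero on {t0..}. *)
definition non_conjugation ::
  "(real \<Rightarrow> real) \<Rightarrow> (real \<Rightarrow> real) \<Rightarrow> (real \<Rightarrow> real) \<Rightarrow> (real \<Rightarrow> real) \<Rightarrow> real \<Rightarrow> real \<Rightarrow> bool"
where
  "non_conjugation a11 a12 a21 a22 t0 t1 \<longleftrightarrow>
    (\<forall>\<phi> \<psi>. solves_system a11 a12 a21 a22 t0 \<phi> \<psi> \<and> (\<exists>t\<ge>t0. \<phi> t \<noteq> 0 \<or> \<psi> t \<noteq> 0)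
      \<longrightarrow> vanishes_at_most_once \<phi> t1 \<and> vanishes_at_most_once \<psi> t1)"

end

theory Submission
  imports Defs
begin

text \<open>
  The integrating factors \<open>exp (- \<integral> a11)\<close> and \<open>exp (- \<integral> a22)\<close> rescale the two components by
  positive functions, so zeros are kept, and turn the system into the off-diagonal one
  \<open>p' = b q\<close>, \<open>q' = c p\<close> with \<open>b, c \<ge> 0\<close> still of unbounded support
  (\<open>solves_system_remove_diagonal\<close>). By the symmetry between \<open>p\<close> and \<open>q\<close> it suffices to study
  the zeros of \<open>p\<close> for this system.

  The product \<open>p q\<close> has derivative \<open>b q\<^sup>2 + c p\<^sup>2 \<ge> 0\<close>. If \<open>p\<close> vanishes at both ends of an interval,
  then the monotone function \<open>p q\<close> vanishes on all of it, so \<open>(p\<^sup>2)' = 2 b p q = 0\<close> there and \<open>p\<close>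
  vanishes on the whole interval (\<open>zero_between_zeros\<close>). Hence the zero set of \<open>p\<close> is a closed
  interval. It cannot be a half-line: at a point of such a half-line where \<open>b\<close> is nonzero,
  \<open>0 = p' = b q\<close> would force \<open>q = 0\<close> as well, and a solution with a common zero of both components
  is trivial (\<open>common_zero_imp_trivial\<close>). A nonempty bounded closed interval is a segment.
\<close>

section \<open>Calculus on a half-line\<close>

lemma nondecreasing_if_deriv_nonneg_within:
  fixes f f' :: "real \<Rightarrow> real"
  assumes "t0 \<le> s" "s \<le> t"
    and deriv: "\<And>x. t0 \<le> x \<Longrightarrow> (f has_real_derivative f' x) (at x within {t0..})"
    and nonneg: "\<And>x. s < x \<Longrightarrow> x < t \<Longrightarrow> 0 \<le> f' x"
  shows "f s \<le> f t"
proof (rule DERIV_nonneg_imp_increasing_open[OF \<open>s \<le> t\<close>])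
  fix x assume x: "s < x" "x < t"
  with \<open>t0 \<le> s\<close> have "at x within {t0..} = at x"
    by (intro at_within_interior) auto
  with deriv[of x] nonneg[of x] x \<open>t0 \<le> s\<close>
  show "\<exists>y. (f has_real_derivative y) (at x) \<and> 0 \<le> y"
    by auto
next
  have "continuous_on {t0..} f"
    using deriv by (intro DERIV_continuous_on) auto
  then show "continuous_on {s..t} f"
    by (rule continuous_on_subset) (use \<open>t0 \<le> s\<close> in auto)
qed

lemma antiderivative_on_half_line:
  fixes f :: "real \<Rightarrow> real"
  assumes "continuous_on {t0..} f"
  obtains F where "\<And>x. t0 \<le> x \<Longrightarrow> (F has_real_derivative f x) (at x within {t0..})"
proof
  fix x assume x: "t0 \<le> x"
  have "((\<lambda>u. integral {t0..u} f) has_real_derivative f x) (at x within {t0..x + 1})"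
    using assms x by (intro integral_has_real_derivative) (auto elim: continuous_on_subset)
  moreover have "at x within {t0..x + 1} = at x within {t0..}"
    by (rule at_within_nhd[where S = "{..<x + 1}"]) auto
  ultimately show "((\<lambda>u. integral {t0..u} f) has_real_derivative f x) (at x within {t0..})"
    by simp
qed

lemma nonzero_beyond_if_unbounded_support:
  fixes b :: "real \<Rightarrow> real"
  assumes "\<not> bounded (closure (support_on {t0..} b))"
  shows "\<exists>t>a. b t \<noteq> 0"
proof (rule ccontr)
  assume "\<not> (\<exists>t>a. b t \<noteq> 0)"
  then have "support_on {t0..} b \<subseteq> {t0..a}"
    by (force simp: support_on_def)
  then have "bounded (closure (support_on {t0..} b))"
    by (meson bounded_closure bounded_closed_interval bounded_subset)
  with assms show False by simp
qed

section \<open>The off-diagonal system\<close>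

locale off_diagonal_solution =
  fixes b c p q :: "real \<Rightarrow> real" and t0 :: real
  assumes cont_b: "continuous_on {t0..} b" and cont_c: "continuous_on {t0..} c"
    and b_nonneg: "\<And>t. t0 \<le> t \<Longrightarrow> 0 \<le> b t" and c_nonneg: "\<And>t. t0 \<le> t \<Longrightarrow> 0 \<le> c t"
    and deriv_p: "\<And>t. t0 \<le> t \<Longrightarrow> (p has_real_derivative b t * q t) (at t within {t0..})"
    and deriv_q: "\<And>t. t0 \<le> t \<Longrightarrow> (q has_real_derivative c t * p t) (at t within {t0..})"
begin

lemma swapped: "off_diagonal_solution c b q p t0"
  by unfold_locales (use cont_b cont_c b_nonneg c_nonneg deriv_p deriv_q in auto)

lemma product_nondecreasing:
  assumes "t0 \<le> s" "s \<le> t"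
  shows "p s * q s \<le> p t * q t"
proof (rule nondecreasing_if_deriv_nonneg_within[OF assms])
  show "((\<lambda>x. p x * q x) has_real_derivative b x * (q x)\<^sup>2 + c x * (p x)\<^sup>2) (at x within {t0..})"
    if "t0 \<le> x" for x
    using deriv_p[OF that] deriv_q[OF that]
    by (auto intro!: derivative_eq_intros simp: power2_eq_square algebra_simps)
  show "0 \<le> b x * (q x)\<^sup>2 + c x * (p x)\<^sup>2" if "s < x" "x < t" for x
    using that assms b_nonneg[of x] c_nonneg[of x] by simp
qed

text \<open>
  The monotone product \<open>p q\<close> is squeezed to \<open>0\<close> between the two zeros of \<open>p\<close>, which makes \<open>p\<^sup>2\<close>
  constant there although nothing is known about the sign of \<open>q\<close>.
\<close>
lemma zero_between_zeros:
  assumes "t0 \<le> s" "s \<le> r" "r \<le> t" "p s = 0" "p t = 0"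
  shows "p r = 0"
proof -
  have product_zero: "p x * q x = 0" if "s < x" "x < r" for x
    using product_nondecreasing[of s x] product_nondecreasing[of x t] that assms by auto
  have "- (p s)\<^sup>2 \<le> - (p r)\<^sup>2"
  proof (rule nondecreasing_if_deriv_nonneg_within[OF assms(1,2)])
    show "((\<lambda>x. - (p x)\<^sup>2) has_real_derivative - 2 * b x * (p x * q x)) (at x within {t0..})"
      if "t0 \<le> x" for x
      using deriv_p[OF that] by (auto intro!: derivative_eq_intros)
    show "0 \<le> - 2 * b x * (p x * q x)" if "s < x" "x < r" for x
      by (simp only: product_zero[OF that] mult_zero_right order_refl)
  qed
  with \<open>p s = 0\<close> show ?thesis by simp
qed

text \<open>
  A Gronwall argument in both time directions: with \<open>B' = b + c\<close>, the function
  \<open>exp B (p\<^sup>2 + q\<^sup>2)\<close> has derivative \<open>exp B (b + c) (p + q)\<^sup>2 \<ge> 0\<close>, while \<open>exp (- B) (p\<^sup>2 + q\<^sup>2)\<close> has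
  derivative \<open>- exp (- B) (b + c) (p - q)\<^sup>2 \<le> 0\<close>. The first carries a common zero to the left,
  the second to the right.
\<close>
lemma common_zero_imp_trivial:
  assumes "t0 \<le> s" "p s = 0" "q s = 0" "t0 \<le> t"
  shows "p t = 0 \<and> q t = 0"
proof -
  define E where "E x = (p x)\<^sup>2 + (q x)\<^sup>2" for x
  have dE: "(E has_real_derivative 2 * (b x + c x) * (p x * q x)) (at x within {t0..})"
    if "t0 \<le> x" for x
    unfolding E_def using deriv_p[OF that] deriv_q[OF that]
    by (auto intro!: derivative_eq_intros simp: algebra_simps)
  have "E s = 0"
    using assms by (simp add: E_def)
  have coeff_nonneg: "0 \<le> b x + c x" if "t0 \<le> x" for x
    using b_nonneg[OF that] c_nonneg[OF that] by simp
  obtain B where dB: "\<And>x. t0 \<le> x \<Longrightarrow> (B has_real_derivative b x + c x) (at x within {t0..})"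
    using antiderivative_on_half_line[of t0 "\<lambda>x. b x + c x"] cont_b cont_c
    by (auto intro: continuous_intros)
  have "E t \<le> 0"
  proof (cases "t \<le> s")
    case True
    have "exp (B t) * E t \<le> exp (B s) * E s"
    proof (rule nondecreasing_if_deriv_nonneg_within[OF \<open>t0 \<le> t\<close> True])
      show "((\<lambda>x. exp (B x) * E x) has_real_derivative
          exp (B x) * (b x + c x) * (p x + q x)\<^sup>2) (at x within {t0..})" if "t0 \<le> x" for x
        by (rule derivative_eq_intros dB[OF that] dE[OF that] refl)+
          (simp add: E_def power2_eq_square algebra_simps)
      show "0 \<le> exp (B x) * (b x + c x) * (p x + q x)\<^sup>2" if "t < x" "x < s" for x
        using coeff_nonneg[of x] that \<open>t0 \<le> t\<close> by simp
    qed
    with \<open>E s = 0\<close> show ?thesis by (simp add: mult_le_0_iff)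
  next
    case False
    have "- (exp (- B s) * E s) \<le> - (exp (- B t) * E t)"
    proof (rule nondecreasing_if_deriv_nonneg_within[OF \<open>t0 \<le> s\<close>])
      show "s \<le> t" using False by simp
      show "((\<lambda>x. - (exp (- B x) * E x)) has_real_derivative
          exp (- B x) * (b x + c x) * (p x - q x)\<^sup>2) (at x within {t0..})" if "t0 \<le> x" for x
        by (rule derivative_eq_intros dB[OF that] dE[OF that] refl)+
          (simp add: E_def power2_eq_square algebra_simps)
      show "0 \<le> exp (- B x) * (b x + c x) * (p x - q x)\<^sup>2" if "s < x" "x < t" for x
        using coeff_nonneg[of x] that \<open>t0 \<le> s\<close> by simp
    qed
    with \<open>E s = 0\<close> show ?thesis by (simp add: mult_le_0_iff)
  qed
  then show ?thesis
    by (simp add: E_def sum_power2_le_zero_iff)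
qed

text \<open>
  If \<open>p\<close> vanishes identically beyond \<open>a\<close>, then so does \<open>p' = b q\<close>, and \<open>q\<close> must vanish wherever
  \<open>b\<close> does not. This is where the unbounded support of \<open>b\<close> is essential: a first component
  whose coefficient \<open>b\<close> has died out could stay at \<open>0\<close> while \<open>q\<close> does not.
\<close>
lemma zero_on_half_line_imp_common_zero:
  assumes "t0 \<le> a" "\<And>t. a \<le> t \<Longrightarrow> p t = 0" "\<exists>t>a. b t \<noteq> 0"
  shows "\<exists>t\<ge>t0. p t = 0 \<and> q t = 0"
proof -
  obtain t where t: "a < t" "b t \<noteq> 0"
    using assms by blast
  have "at t within {t0..} = at t"
    using t assms(1) by (intro at_within_interior) auto
  with deriv_p[of t] t assms(1) have "(p has_real_derivative b t * q t) (at t)"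
    by simp
  moreover have "(p has_real_derivative 0) (at t)"
    by (rule has_field_derivative_transform_within_open[of "\<lambda>_. 0" _ _ "{a<..}"])
      (use t assms(2) in auto)
  ultimately have "b t * q t = 0"
    by (rule DERIV_unique)
  with t assms show ?thesis by (intro exI[of _ t]) auto
qed

lemma first_component_vanishes_at_most_once:
  assumes beyond: "\<And>a. \<exists>t>a. b t \<noteq> 0"
    and nontrivial: "\<exists>t\<ge>t0. p t \<noteq> 0 \<or> q t \<noteq> 0"
  shows "vanishes_at_most_once p t0"
proof (cases "{t \<in> {t0..}. p t = 0} = {}")
  case True
  then show ?thesis by (simp add: vanishes_at_most_once_def)
next
  case False
  define Z where "Z = {t \<in> {t0..}. p t = 0}"
  with False obtain a where a: "t0 \<le> a" "p a = 0" by auto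
  have "continuous_on {t0..} p"
    using deriv_p by (intro DERIV_continuous_on) auto
  then have "closed Z"
    unfolding Z_def by (intro continuous_closed_preimage_constant) auto
  have interval: "is_interval Z"
    unfolding is_interval_1 Z_def using zero_between_zeros by auto
  have "\<not> (\<forall>t\<ge>a. p t = 0)"
  proof
    assume "\<forall>t\<ge>a. p t = 0"
    then obtain s where "t0 \<le> s" "p s = 0" "q s = 0"
      using zero_on_half_line_imp_common_zero[OF a(1) _ beyond] by auto
    with common_zero_imp_trivial nontrivial show False by metis
  qed
  then obtain r where r: "a \<le> r" "p r \<noteq> 0" by auto
  have "t \<le> r" if "p t = 0" for t
    using zero_between_zeros[OF a(1) r(1) _ a(2) that] r(2) by linarith
  then have "Z \<subseteq> {t0..r}"
    by (auto simp: Z_def)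
  then have "bounded Z"
    by (rule bounded_subset[rotated]) simp
  with \<open>closed Z\<close> interval obtain l u where "Z = {l..u}"
    by (metis connected_compact_interval_1 compact_eq_bounded_closed is_interval_connected_1)
  moreover from this have "l \<le> u"
    using False[folded Z_def] by simp
  ultimately show ?thesis
    unfolding vanishes_at_most_once_def Z_def by blast
qed

end

section \<open>Removing the diagonal\<close>

text \<open>
  With antiderivatives \<open>A1\<close> of \<open>a11\<close> and \<open>A2\<close> of \<open>a22\<close>, the pair \<open>exp (- A1) \<phi>\<close>, \<open>exp (- A2) \<psi>\<close>
  has off-diagonal coefficients \<open>exp (A2 - A1) a12\<close> and \<open>exp (A1 - A2) a21\<close>.
\<close>
lemma solves_system_remove_diagonal:
  assumes cont: "continuous_on {t0..} a11" "continuous_on {t0..} a12"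
      "continuous_on {t0..} a21" "continuous_on {t0..} a22"
    and nonneg: "\<And>t. t0 \<le> t \<Longrightarrow> 0 \<le> a12 t" "\<And>t. t0 \<le> t \<Longrightarrow> 0 \<le> a21 t"
    and sol: "solves_system a11 a12 a21 a22 t0 \<phi> \<psi>"
  obtains A1 A2 where "off_diagonal_solution
    (\<lambda>t. exp (A2 t - A1 t) * a12 t) (\<lambda>t. exp (A1 t - A2 t) * a21 t)
    (\<lambda>t. exp (- A1 t) * \<phi> t) (\<lambda>t. exp (- A2 t) * \<psi> t) t0"
proof -
  obtain A1 where A1: "\<And>x. t0 \<le> x \<Longrightarrow> (A1 has_real_derivative a11 x) (at x within {t0..})"
    using antiderivative_on_half_line[OF cont(1)] by blast
  obtain A2 where A2: "\<And>x. t0 \<le> x \<Longrightarrow> (A2 has_real_derivative a22 x) (at x within {t0..})"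
    using antiderivative_on_half_line[OF cont(4)] by blast
  have cont_A: "continuous_on {t0..} A1" "continuous_on {t0..} A2"
    using A1 A2 by (auto intro!: DERIV_continuous_on)
  have d\<phi>: "(\<phi> has_real_derivative a11 t * \<phi> t + a12 t * \<psi> t) (at t within {t0..})"
    and d\<psi>: "(\<psi> has_real_derivative a21 t * \<phi> t + a22 t * \<psi> t) (at t within {t0..})"
    if "t0 \<le> t" for t
    using sol that unfolding solves_system_def by blast+
  have "off_diagonal_solution
    (\<lambda>t. exp (A2 t - A1 t) * a12 t) (\<lambda>t. exp (A1 t - A2 t) * a21 t)
    (\<lambda>t. exp (- A1 t) * \<phi> t) (\<lambda>t. exp (- A2 t) * \<psi> t) t0"
  proof
    show "continuous_on {t0..} (\<lambda>t. exp (A2 t - A1 t) * a12 t)"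
      "continuous_on {t0..} (\<lambda>t. exp (A1 t - A2 t) * a21 t)"
      by (intro continuous_intros cont cont_A)+
    fix t assume t: "t0 \<le> t"
    show "0 \<le> exp (A2 t - A1 t) * a12 t" "0 \<le> exp (A1 t - A2 t) * a21 t"
      using nonneg[OF t] by simp_all
    show "((\<lambda>t. exp (- A1 t) * \<phi> t) has_real_derivative
        exp (A2 t - A1 t) * a12 t * (exp (- A2 t) * \<psi> t)) (at t within {t0..})"
      by (rule derivative_eq_intros A1[OF t] d\<phi>[OF t] refl)+
        (simp add: algebra_simps flip: exp_add)
    show "((\<lambda>t. exp (- A2 t) * \<psi> t) has_real_derivative
        exp (A1 t - A2 t) * a21 t * (exp (- A1 t) * \<phi> t)) (at t within {t0..})"
      by (rule derivative_eq_intros A2[OF t] d\<psi>[OF t] refl)+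
        (simp add: algebra_simps flip: exp_add)
  qed
  then show thesis by (rule that)
qed

section \<open>The non conjugation condition\<close>

theorem theorem3p7:
  fixes a11 a12 a21 a22 :: "real \<Rightarrow> real" and t0 :: real
  assumes "continuous_on {t0..} a11" and "continuous_on {t0..} a12"
    and "continuous_on {t0..} a21" and "continuous_on {t0..} a22"
    and "\<not> bounded (closure (support_on {t0..} a12))"
    and "\<not> bounded (closure (support_on {t0..} a21))"
    and "\<And>t. t \<ge> t0 \<Longrightarrow> a12 t \<ge> 0" and "\<And>t. t \<ge> t0 \<Longrightarrow> a21 t \<ge> 0"
  shows "non_conjugation a11 a12 a21 a22 t0 t0"
  unfolding non_conjugation_def
proof (intro allI impI, elim conjE)
  fix \<phi> \<psi>
  assume sol: "solves_system a11 a12 a21 a22 t0 \<phi> \<psi>"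
    and nontrivial: "\<exists>t\<ge>t0. \<phi> t \<noteq> 0 \<or> \<psi> t \<noteq> 0"
  obtain A1 A2 where off: "off_diagonal_solution
      (\<lambda>t. exp (A2 t - A1 t) * a12 t) (\<lambda>t. exp (A1 t - A2 t) * a21 t)
      (\<lambda>t. exp (- A1 t) * \<phi> t) (\<lambda>t. exp (- A2 t) * \<psi> t) t0"
    using solves_system_remove_diagonal[OF assms(1-4,7,8) sol] by blast
  have "vanishes_at_most_once (\<lambda>t. exp (- A1 t) * \<phi> t) t0"
    by (rule off_diagonal_solution.first_component_vanishes_at_most_once[OF off])
      (use nontrivial nonzero_beyond_if_unbounded_support[OF assms(5)] in auto)
  moreover have "vanishes_at_most_once (\<lambda>t. exp (- A2 t) * \<psi> t) t0"
    by (rule off_diagonal_solution.first_component_vanishes_at_most_once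
          [OF off_diagonal_solution.swapped[OF off]])
      (use nontrivial nonzero_beyond_if_unbounded_support[OF assms(6)] in auto)
  ultimately show "vanishes_at_most_once \<phi> t0 \<and> vanishes_at_most_once \<psi> t0"
    by (simp add: vanishes_at_most_once_def)
qed

end
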